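(* Let $K$ be a field of characteristic $2$, $\theta$ a Tits endomorphism of $K$, $k=K^\theta$, and $L$ a $k$-subspace of $K$ with $1\in L$ and $k[L]=K$. Let $M(U,\tau)=\mathrm{MSuz}(K,L,\theta)$ be the generalized Suzuki Moufang set, with Hua subgroup $H$. Then the following statements are equivalent: (a) $\theta$ is surjective. (b) $K$ is perfect. (c) $U$ has a Suzuki partition. (d) $H$ acts transitively on $Z(U)^\#=Z(U)\setminus\{0\}$. (e) For every $a\in U^\#$ there is a $b\in Z(U)^\#$ with $a\in V_b$.
   Context: Permutations act on the right and $g^h=h^{-1}gh$. A Tits endomorphism of a field $K$ of characteristic $2$ is an endomorphism $\theta$ such that $\theta^2$ is the Frobenius endomorphism $x\mapsto x^2$; $K^\theta$ is its image; $k[L]$ is the subring generated by $k$ and $L$. Exponents: $a^{n+\theta}=a^na^\theta$. $Z(U)$ denotes the center of the group $U$. The generalized Suzuki Moufang set $\mathrm{MSuz}(K,L,\theta)$: let $U=A(K,L,\theta)$ be the set $L\times L$ with the group operation $(a,b)+(c,d)=(a+c,\,b+d+ac^\theta)$, with neutral element $0=(0,0)$; $U^\#=U\setminus\{0\}$. For $a,b\in K$ let $N(a,b)=a^{2+\theta}+ab+b^\theta$, which is zero only if $a=b=0$. Let $X=U\cup\{\infty\}$ and let $\tau\in\mathrm{Sym}(X)$ interchange $0$ and $\infty$ and satisfy $(a,b)\tau=\left(\frac{b}{N(a,b)},\frac{a}{N(a,b)}\right)$ for $(a,b)\in U^\#$. For $u\in U$ let $\alpha_u\in\mathrm{Sym}(X)$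 fix $\infty$ and map $v\mapsto v+u$ on $U$. Put $U_\infty=\{\alpha_u\mid u\in U\}$ and $U_u=U_\infty^{\tau\alpha_u}$. Then $M(U,\tau)=(X,(U_x)_{x\in X})$ is $\mathrm{MSuz}(K,L,\theta)$; it is a Moufang set (each $U_x$ fixes $x$ and acts regularly on $X\setminus\{x\}$, and $U_x^g=U_{xg}$ for all $x\in X$ and $g\in\langle U_y\mid y\in X\rangle$). For $a\in U^\#$: $\mu_a=\alpha_{(-a)\tau^{-1}}^{\tau}\,\alpha_a\,\alpha_{-(a\tau^{-1})}^{\tau}$; $V_a=\{b\in U^\#\mid\mu_b=\mu_a\}$; $\sim a:=(-(a\tau^{-1}))\tau$. The Hua subgroup is $H=\langle\mu_a\mu_b\mid a,b\in U^\#\rangle$; it fixes $0$ and $\infty$ and acts on $U$ by automorphisms. $U$ has a Suzuki partition means that $U$ is the union of the following four sets and that they form a partition of $U$: $Z(U)$, $\ \{\sim a\mid a\in Z(U)^\#\}$, $\ \{-(\sim a)\mid a\in Z(U)^\#\}$, $\ \{-(\sim a)+(\sim b)\mid a,b\in Z(U)^\#,\ a\neq b\}$.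
   Formalization: The formal statement also assumes that K is not the field with two elements; for K = F_2 (θ = id, L = K) the group U is cyclic of order 4, so Z(U) = U and H is trivial, and (a) holds while (c) and (d) fail. *)

theory Defs
  imports
    "HOL-Algebra.Algebraic_Closure_Type"
    "HOL-Algebra.Generated_Rings"
    "HOL-Algebra.Generated_Groups"
    "HOL-Combinatorics.Permutations"
    "HOL-Library.Disjoint_Sets"
begin

section \<open>Fields with a Tits endomorphism\<close>

text \<open>
  The field is the whole type \<open>'a\<close>; \<open>ring_of_type_algebra\<close> is that type viewed as a ring record.
\<close>

abbreviation field_rec :: "'a::field ring" where
  "field_rec \<equiv> ring_of_type_algebra"

definition tits_endomorphism :: "('a::field \<Rightarrow> 'a) \<Rightarrow> bool" where
  "tits_endomorphism \<theta> \<longleftrightarrow> \<theta> \<in> ring_hom field_rec field_rec \<and> (\<forall>x. \<theta> (\<theta> x) = x ^ 2)"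

definition subspace_over :: "'a::field set \<Rightarrow> 'a set \<Rightarrow> bool" where
  "subspace_over k L \<longleftrightarrow>
     0 \<in> L \<and> (\<forall>x\<in>L. \<forall>y\<in>L. x + y \<in> L) \<and> (\<forall>c\<in>k. \<forall>x\<in>L. c * x \<in> L)"

definition perfect_field :: "'a::field itself \<Rightarrow> bool" where
  "perfect_field _ \<longleftrightarrow> CHAR('a) = 0 \<or> surj (\<lambda>x::'a. x ^ CHAR('a))"


section \<open>The construction $M(U,\tau)$\<close>

text \<open>
  A group \<open>U\<close>, written additively in the mathematics, is a \<open>monoid\<close> record: \<open>+\<close>, \<open>0\<close>, \<open>-u\<close> are
  its \<open>\<otimes>\<close>, \<open>\<one>\<close>, \<open>inv u\<close>. The point set is \<open>U \<union> {\<infinity>}\<close> with \<open>\<infinity> = None\<close>.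
  The Moufang set is represented by the pair \<open>(U, \<tau>)\<close>, on which everything below depends.
\<close>

definition center :: "('g, 'm) monoid_scheme \<Rightarrow> 'g set" where
  "center G = {z \<in> carrier G. \<forall>g \<in> carrier G. z \<otimes>\<^bsub>G\<^esub> g = g \<otimes>\<^bsub>G\<^esub> z}"

definition nonid :: "('g, 'm) monoid_scheme \<Rightarrow> 'g set" where
  "nonid G = carrier G - {\<one>\<^bsub>G\<^esub>}"

definition conjugate :: "('g, 'm) monoid_scheme \<Rightarrow> 'g \<Rightarrow> 'g \<Rightarrow> 'g" where
  "conjugate G g h = inv\<^bsub>G\<^esub> h \<otimes>\<^bsub>G\<^esub> g \<otimes>\<^bsub>G\<^esub> h"

text \<open>Permutations act on the right, so a product \<open>g h\<close> applies \<open>g\<close> first.\<close>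

definition sym_right :: "'x set \<Rightarrow> ('x \<Rightarrow> 'x) monoid" where
  "sym_right S = \<lparr>carrier = {g. g permutes S}, monoid.mult = (\<lambda>g h. h \<circ> g), one = id\<rparr>"

definition points :: "('g, 'm) monoid_scheme \<Rightarrow> 'g option set" where
  "points U = insert None (Some ` carrier U)"

abbreviation sym_points :: "('g, 'm) monoid_scheme \<Rightarrow> ('g option \<Rightarrow> 'g option) monoid" where
  "sym_points U \<equiv> sym_right (points U)"

definition translation :: "('g, 'm) monoid_scheme \<Rightarrow> 'g \<Rightarrow> 'g option \<Rightarrow> 'g option" where
  "translation U u x =
     (case x of None \<Rightarrow> None
      | Some v \<Rightarrow> if v \<in> carrier U then Some (v \<otimes>\<^bsub>U\<^esub> u) else Some v)"

text \<open>Only used for \<open>g\<close> and \<open>u\<close> such that \<open>u g \<noteq> \<infinity>\<close>.\<close>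

definition act :: "'g \<Rightarrow> ('g option \<Rightarrow> 'g option) \<Rightarrow> 'g" where
  "act u g = the (g (Some u))"

definition mu :: "('g, 'm) monoid_scheme \<Rightarrow> ('g option \<Rightarrow> 'g option) \<Rightarrow> 'g \<Rightarrow> 'g option \<Rightarrow> 'g option" where
  "mu U \<tau> a =
     conjugate (sym_points U) (translation U (act (inv\<^bsub>U\<^esub> a) (inv\<^bsub>sym_points U\<^esub> \<tau>))) \<tau>
     \<otimes>\<^bsub>sym_points U\<^esub> translation U a
     \<otimes>\<^bsub>sym_points U\<^esub> conjugate (sym_points U) (translation U (inv\<^bsub>U\<^esub> (act a (inv\<^bsub>sym_points U\<^esub> \<tau>)))) \<tau>"

definition mu_class :: "('g, 'm) monoid_scheme \<Rightarrow> ('g option \<Rightarrow> 'g option) \<Rightarrow> 'g \<Rightarrow> 'g set" where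
  "mu_class U \<tau> a = {b \<in> nonid U. mu U \<tau> b = mu U \<tau> a}"

definition tilde :: "('g, 'm) monoid_scheme \<Rightarrow> ('g option \<Rightarrow> 'g option) \<Rightarrow> 'g \<Rightarrow> 'g" where
  "tilde U \<tau> a = act (inv\<^bsub>U\<^esub> (act a (inv\<^bsub>sym_points U\<^esub> \<tau>))) \<tau>"

definition hua_subgroup ::
    "('g, 'm) monoid_scheme \<Rightarrow> ('g option \<Rightarrow> 'g option) \<Rightarrow> ('g option \<Rightarrow> 'g option) set" where
  "hua_subgroup U \<tau> =
     generate (sym_points U)
       {mu U \<tau> a \<otimes>\<^bsub>sym_points U\<^esub> mu U \<tau> b | a b. a \<in> nonid U \<and> b \<in> nonid U}"

definition transitive_on :: "('g option \<Rightarrow> 'g option) set \<Rightarrow> 'g set \<Rightarrow> bool" where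
  "transitive_on H A \<longleftrightarrow> (\<forall>x\<in>A. \<forall>y\<in>A. \<exists>h\<in>H. h (Some x) = Some y)"

text \<open>
  Distinctness is needed because \<open>partition_on\<close> takes a set of parts, in which equal parts would be
  identified.
\<close>

definition has_suzuki_partition ::
    "('g, 'm) monoid_scheme \<Rightarrow> ('g option \<Rightarrow> 'g option) \<Rightarrow> bool" where
  "has_suzuki_partition U \<tau> \<longleftrightarrow>
     (let Z' = center U - {\<one>\<^bsub>U\<^esub>};
          parts =
            [center U,
             {tilde U \<tau> a | a. a \<in> Z'},
             {inv\<^bsub>U\<^esub> (tilde U \<tau> a) | a. a \<in> Z'},
             {inv\<^bsub>U\<^esub> (tilde U \<tau> a) \<otimes>\<^bsub>U\<^esub> tilde U \<tau> b | a b. a \<in> Z' \<and> b \<in> Z' \<and> a \<noteq> b}]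
      in partition_on (carrier U) (set parts) \<and> distinct parts)"


section \<open>The generalized Suzuki Moufang set\<close>

text \<open>
  Over the field with two elements (where \<open>\<theta> = id\<close>) the group below is cyclic of order 4, hence equal
  to its center. There \<open>\<theta>\<close> is surjective, but \<open>U\<close> has no Suzuki partition and the Hua subgroup is
  trivial, so results relating these properties need \<open>\<bar>K\<bar> \<noteq> 2\<close>. For every other \<open>K\<close> the center is
  \<open>{0} \<times> L\<close>.
\<close>

definition suzuki_group :: "'a::field set \<Rightarrow> ('a \<Rightarrow> 'a) \<Rightarrow> ('a \<times> 'a) monoid" where
  "suzuki_group L \<theta> =
     \<lparr>carrier = L \<times> L,
      monoid.mult = (\<lambda>(a, b) (c, d). (a + c, b + d + a * \<theta> c)),
      one = (0, 0)\<rparr>"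

definition suzuki_norm :: "('a::field \<Rightarrow> 'a) \<Rightarrow> 'a \<Rightarrow> 'a \<Rightarrow> 'a" where
  "suzuki_norm \<theta> a b = a ^ 2 * \<theta> a + a * b + \<theta> b"

definition suzuki_tau ::
    "'a::field set \<Rightarrow> ('a \<Rightarrow> 'a) \<Rightarrow> ('a \<times> 'a) option \<Rightarrow> ('a \<times> 'a) option" where
  "suzuki_tau L \<theta> x =
     (case x of None \<Rightarrow> Some (0, 0)
      | Some (a, b) \<Rightarrow>
          if (a, b) = (0, 0) then None
          else if (a, b) \<in> L \<times> L then Some (b / suzuki_norm \<theta> a b, a / suzuki_norm \<theta> a b)
          else x)"

end

(*
  The permutation mu_u is tau followed by the diagonal automorphism (x, y) |-> (l x, l^(1+theta) y)
  of U, where l = N(u)^(2-theta) lies in k and l^(1+theta) = N(u)^theta.  Hence the Hua subgroup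
  acts on Z(U) = 0 x L by multiplications with elements of k, and mu_u = mu_v exactly when
  N(u) = N(v).  On the center, N(0, t) = t^theta, and for r = t^(theta-1) the element ~(0, t) is
  (r, r^(1+theta)); the last part of the partition then consists of the elements (c, c s^theta)
  with s different from 0 and c.  Each of (c), (d), (e) therefore says, or at least implies, that
  L is contained in k, and then K = k[L] = k.  Conversely, everything is solvable when L = K = k.
*)
theory Submission
  imports Defs
begin

section \<open>Preliminaries on partitions, images and permutation groups\<close>

lemma partition_on_four:
  assumes "A \<union> B \<union> C \<union> D = S"
    and disj: "A \<inter> B = {}" "A \<inter> C = {}" "A \<inter> D = {}" "B \<inter> C = {}" "B \<inter> D = {}" "C \<inter> D = {}"
    and ne: "A \<noteq> {}" "B \<noteq> {}" "C \<noteq> {}" "D \<noteq> {}"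
  shows "partition_on S {A, B, C, D}" "distinct [A, B, C, D]"
proof -
  show "partition_on S {A, B, C, D}"
    unfolding partition_on_def
  proof (intro conjI)
    show "disjoint {A, B, C, D}"
      unfolding disjoint_def by (simp add: disj Int_commute[of B A] Int_commute[of C A]
          Int_commute[of D A] Int_commute[of C B] Int_commute[of D B] Int_commute[of D C])
  qed (use assms(1) ne in \<open>simp_all add: Un_assoc\<close>)
  have "A \<noteq> B" "A \<noteq> C" "A \<noteq> D" "B \<noteq> C" "B \<noteq> D" "C \<noteq> D"
    using disj ne by (metis Int_absorb)+
  then show "distinct [A, B, C, D]" by simp
qed

lemma image_comprehension: "{f a | a. a \<in> g ` S} = {f (g r) | r. r \<in> S}"
  by blast

text \<open>Injectivity turns distinctness of two central elements into distinctness of their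
  parameters, as needed for the fourth part of a Suzuki partition.\<close>

lemma pairs_image:
  assumes "inj_on g S"
  shows "{f a b | a b. a \<in> g ` S \<and> b \<in> g ` S \<and> a \<noteq> b} = {f (g r) (g s) | r s. r \<in> S \<and> s \<in> S \<and> r \<noteq> s}"
  (is "?A = ?B")
proof
  show "?B \<subseteq> ?A"
  proof
    fix x assume "x \<in> ?B"
    then obtain r s where "x = f (g r) (g s)" "r \<in> S" "s \<in> S" "g r \<noteq> g s"
      using assms by (auto dest: inj_onD)
    then show "x \<in> ?A" by blast
  qed
qed blast

lemma permutes_inverse_pair:
  assumes "\<And>x. x \<notin> S \<Longrightarrow> g x = x" "g \<circ> h = id" "h \<circ> g = id"
  shows "g permutes S"
  using o_bij[OF assms(3,2)] assms(1) unfolding permutes_def bij_iff by blast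

lemma sym_right_group: "group (sym_right S)"
proof (rule groupI)
  fix g assume "g \<in> carrier (sym_right S)"
  then have "g permutes S" by (simp add: sym_right_def)
  then show "\<exists>h\<in>carrier (sym_right S). h \<otimes>\<^bsub>sym_right S\<^esub> g = \<one>\<^bsub>sym_right S\<^esub>"
    by (intro bexI[of _ "inv_into UNIV g"])
      (simp_all add: sym_right_def permutes_inv permutes_inv_o)
qed (auto simp: sym_right_def permutes_compose permutes_id o_assoc)

lemma sym_right_inv:
  assumes "g permutes S" "h permutes S" "g \<circ> h = id"
  shows "inv\<^bsub>sym_right S\<^esub> g = h"
  by (rule group.inv_equality[OF sym_right_group]) (use assms in \<open>simp_all add: sym_right_def\<close>)

lemma sym_right_mult: "g \<otimes>\<^bsub>sym_right S\<^esub> h = h \<circ> g"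
  by (simp add: sym_right_def)

section \<open>Tits endomorphisms in characteristic 2\<close>

lemma char_two_add_self:
  assumes "CHAR('a::field) = 2"
  shows "(x::'a) + x = 0"
proof -
  have "(2::'a) = 0" using of_nat_CHAR[where ?'a = 'a] assms by simp
  then show ?thesis by (simp flip: mult_2)
qed

locale tits_field =
  fixes \<theta> :: "'a::field \<Rightarrow> 'a"
  assumes add_self [simp]: "(x::'a) + x = 0"
    and theta_add [simp]: "\<theta> (x + y) = \<theta> x + \<theta> y"
    and theta_mult [simp]: "\<theta> (x * y) = \<theta> x * \<theta> y"
    and theta_one [simp]: "\<theta> 1 = 1"
    and theta_theta [simp]: "\<theta> (\<theta> x) = x\<^sup>2"
begin

lemma add_self_left [simp]: "(x::'a) + (x + y) = y"
  using add_self[of x] by (simp flip: add.assoc)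

lemma two_eq_zero [simp]: "(2::'a) = 0"
  using add_self[of 1] by (simp only: one_add_one)

lemma eq_iff_add_eq_zero: "(x::'a) = y \<longleftrightarrow> x + y = 0"
  by (metis add_self add_self_left add.right_neutral)

lemma theta_zero [simp]: "\<theta> 0 = 0"
  using theta_add[of 0 0] by simp

text \<open>If \<open>\<theta> x = 0\<close>, then \<open>x^2 = \<theta> (\<theta> x) = 0\<close>.
  Additivity then gives injectivity.\<close>

lemma theta_eq_zero_iff [simp]: "\<theta> x = 0 \<longleftrightarrow> x = 0"
  by (metis theta_theta theta_zero power2_eq_square mult_eq_0_iff)

lemma theta_eq_iff [simp]: "\<theta> x = \<theta> y \<longleftrightarrow> x = y"
  by (metis eq_iff_add_eq_zero theta_add theta_eq_zero_iff)

lemma theta_power [simp]: "\<theta> (x ^ n) = \<theta> x ^ n"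
  by (induction n) simp_all

lemma theta_inverse [simp]: "\<theta> (inverse x) = inverse (\<theta> x)"
proof (cases "x = 0")
  case False
  then have "\<theta> x * \<theta> (inverse x) = 1" by (simp flip: theta_mult)
  then show ?thesis by (simp add: inverse_unique)
qed simp

lemma theta_divide [simp]: "\<theta> (x / y) = \<theta> x / \<theta> y"
  by (simp add: divide_inverse)

section \<open>The norm and its behaviour under the group operation and \<tau>\<close>

abbreviation N where "N \<equiv> suzuki_norm \<theta>"

lemma theta_norm: "\<theta> (N a b) = a\<^sup>2 * (\<theta> a)\<^sup>2 + \<theta> a * \<theta> b + b\<^sup>2"
  by (simp add: suzuki_norm_def algebra_simps)

text \<open>Applying \<theta> to \<open>N a b = 0\<close> and substituting \<open>\<theta> b\<close>
  from the same equation leaves a product of \<open>b\<close> and \<open>b + a \<theta>(a)\<close>;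
  the vanishing of either factor forces \<open>a\<close> and \<open>b\<close> to vanish.\<close>

lemma norm_eq_zero_iff [simp]: "N a b = 0 \<longleftrightarrow> a = 0 \<and> b = 0"
proof
  assume N: "N a b = 0"
  then have B: "\<theta> b = a\<^sup>2 * \<theta> a + a * b"
    by (metis eq_iff_add_eq_zero suzuki_norm_def)
  have "0 = a\<^sup>2 * (\<theta> a)\<^sup>2 + \<theta> a * \<theta> b + b\<^sup>2"
    using theta_norm[of a b] N by simp
  also have "\<dots> = b * (b + a * \<theta> a)"
    unfolding B by (simp add: algebra_simps power2_eq_square)
  finally consider "b = 0" | "b = a * \<theta> a"
    by (metis eq_iff_add_eq_zero mult_eq_0_iff)
  then show "a = 0 \<and> b = 0"
    by cases (use B in \<open>auto simp: power2_eq_square algebra_simps\<close>)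
qed (simp add: suzuki_norm_def)

lemma norm_zero_left: "N 0 b = \<theta> b"
  by (simp add: suzuki_norm_def)

lemma norm_add:
  "N (x + a) (y + b + x * \<theta> a) = N x y + N a b + x * b + a * y + x * a * \<theta> a"
  by (simp add: suzuki_norm_def algebra_simps power2_eq_square)

text \<open>The arguments on the left are the coordinates of \<open>-(a, b)\<close>.\<close>

lemma norm_neg [simp]: "N a (b + a * \<theta> a) = N a b"
  by (simp add: suzuki_norm_def algebra_simps power2_eq_square)

text \<open>Since \<theta> squared is 2 in exponents, each of the three terms of the norm scales by
  \<open>l^(2+\<theta>)\<close>.\<close>

lemma norm_scale: "N (l * a) (l * \<theta> l * b) = l\<^sup>2 * \<theta> l * N a b"
  by (simp add: suzuki_norm_def algebra_simps power2_eq_square)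

text \<open>Clearing denominators leaves a polynomial identity. It is what makes \<tau> an
  involution.\<close>

lemma norm_tau: "N (b / N a b) (a / N a b) = 1 / N a b"
proof (cases "N a b = 0")
  case False
  define n where "n = N a b"
  have n: "n \<noteq> 0" "\<theta> n \<noteq> 0" using False by (simp_all add: n_def)
  have "b\<^sup>2 * \<theta> b + a * b * \<theta> n + \<theta> a * n\<^sup>2 = n * \<theta> n"
    unfolding n_def theta_norm by (simp add: suzuki_norm_def algebra_simps power2_eq_square)
  then show ?thesis using n unfolding n_def[symmetric]
    by (simp add: suzuki_norm_def field_simps power2_eq_square)
qed (simp add: suzuki_norm_def)

text \<open>For \<open>u = (a, b)\<close> the norm of \<open>-u\<close> is \<open>m\<close>, so
  \<open>(-u)\<tau> = (c, a/m)\<close>; the left side is the second coordinate of the negative of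
  this point.\<close>

lemma tau_neg_second:
  assumes "a \<noteq> 0 \<or> b \<noteq> 0"
  defines "m \<equiv> N a b" and "c \<equiv> (b + a * \<theta> a) / N a b"
  shows "a / m + c * \<theta> c = b / \<theta> m"
proof -
  have m: "m \<noteq> 0" "\<theta> m \<noteq> 0" using assms(1) by (simp_all add: m_def)
  have "a * \<theta> m + (b + a * \<theta> a) * (\<theta> b + \<theta> a * a\<^sup>2) = b * m"
    unfolding m_def theta_norm by (simp add: suzuki_norm_def algebra_simps power2_eq_square)
  then show ?thesis using m unfolding c_def m_def[symmetric]
    by (simp add: field_simps power2_eq_square)
qed

text \<open>
  The argument of the norm is \<open>w\<tau> - (-u)\<tau>\<close> for \<open>w = (x, y)\<close> and \<open>u = (a, b)\<close>.
\<close>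

lemma norm_tau_add:
  assumes "a \<noteq> 0 \<or> b \<noteq> 0" "x \<noteq> 0 \<or> y \<noteq> 0"
  defines "n \<equiv> N x y" and "m \<equiv> N a b" and "c \<equiv> (b + a * \<theta> a) / N a b"
  shows "N (y / n + c) (x / n + (a / m + c * \<theta> c) + y / n * \<theta> c)
    = N (x + a) (y + b + x * \<theta> a) / (n * m)"
proof -
  have nz: "n \<noteq> 0" "m \<noteq> 0" using assms(1,2) by (simp_all add: n_def m_def)
  have c: "c = (b + a * \<theta> a) / m" by (simp add: c_def m_def)
  have "N c (a / m + c * \<theta> c) = 1 / m"
    unfolding norm_neg using norm_tau[of "b + a * \<theta> a" a] unfolding c_def m_def norm_neg .
  moreover have "N (y / n) (x / n) = 1 / n"
    unfolding n_def by (rule norm_tau)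
  ultimately have "N (y / n + c) (x / n + (a / m + c * \<theta> c) + y / n * \<theta> c)
      = 1 / n + 1 / m + y / n * (a / m) + c * (x / n)"
    unfolding norm_add by (simp add: distrib_left ac_simps del: theta_divide)
  also have "\<dots> = (n + m + x * b + a * y + x * a * \<theta> a) / (n * m)"
    unfolding c using nz by (simp add: field_simps)
  finally show ?thesis unfolding norm_add n_def m_def .
qed

text \<open>The power \<open>N^(2-\<theta>)\<close> written as a quotient; for
  \<open>a = b = 0\<close> division by zero makes it 0.\<close>

definition mu_factor where "mu_factor a b = (N a b)\<^sup>2 / \<theta> (N a b)"

lemma theta_mu_factor: "\<theta> (mu_factor a b) = (\<theta> (N a b))\<^sup>2 / (N a b)\<^sup>2"
  by (simp only: mu_factor_def theta_divide theta_power theta_theta)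

text \<open>In exponents,
  \<open>(2-\<theta>)(1+\<theta>) = 2 + \<theta> - 2 = \<theta>\<close>.\<close>

lemma mu_factor_mult_theta: "mu_factor a b * \<theta> (mu_factor a b) = \<theta> (N a b)"
  by (cases "N a b = 0") (simp_all only: theta_mu_factor mu_factor_def theta_zero, simp_all add: power2_eq_square)

text \<open>
  The two coordinates of \<open>(w + u)\<tau> = (w\<tau> - (-u)\<tau>)h\<tau> + u\<tau>\<close>; here \<open>m * p / n\<close> is the norm of
  \<open>(w\<tau> - (-u)\<tau>)h\<close>.
\<close>

lemma tau_add_first:
  assumes "a \<noteq> 0 \<or> b \<noteq> 0" "x \<noteq> 0 \<or> y \<noteq> 0"
  defines "n \<equiv> N x y" and "m \<equiv> N a b" and "p \<equiv> N (x + a) (y + b + x * \<theta> a)"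
  assumes "p \<noteq> 0"
  shows "\<theta> m * (x / n + b / \<theta> m + y / n * ((\<theta> b + \<theta> a * a\<^sup>2) / \<theta> m)) / (m * p / n) + b / m
    = (y + b + x * \<theta> a) / p"
proof -
  have nz: "n \<noteq> 0" "m \<noteq> 0" "\<theta> m \<noteq> 0" using assms(1,2) by (simp_all add: n_def m_def)
  \<comment> \<open>Here \<open>p\<close> is expanded by \<open>norm_add\<close> while
    \<open>n\<close> stays a symbol: \<open>b n\<close> cancels against its copy in
    \<open>b p\<close>.\<close>
  have "x * \<theta> m + b * n + y * (\<theta> b + \<theta> a * a\<^sup>2) + b * p = (y + b + x * \<theta> a) * m"
    unfolding p_def norm_add n_def[symmetric] m_def theta_norm
    by (simp add: suzuki_norm_def algebra_simps power2_eq_square)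
  then have "(y + b + x * \<theta> a) / p
      = (x * \<theta> m + b * n + y * (\<theta> b + \<theta> a * a\<^sup>2) + b * p) / (p * m)"
    using nz by simp
  also have "\<dots> = (x * \<theta> m + b * n + y * (\<theta> b + \<theta> a * a\<^sup>2)) / (p * m) + b / m"
    using nz \<open>p \<noteq> 0\<close> by (simp add: add_divide_distrib)
  also have "(x * \<theta> m + b * n + y * (\<theta> b + \<theta> a * a\<^sup>2)) / (p * m)
      = \<theta> m * (x / n + b / \<theta> m + y / n * ((\<theta> b + \<theta> a * a\<^sup>2) / \<theta> m)) / (m * p / n)"
    using nz \<open>p \<noteq> 0\<close> by (simp add: divide_simps) (simp add: algebra_simps)?
  finally show ?thesis by simp
qed

lemma tau_add_second:
  assumes "a \<noteq> 0 \<or> b \<noteq> 0" "x \<noteq> 0 \<or> y \<noteq> 0"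
  defines "n \<equiv> N x y" and "m \<equiv> N a b" and "p \<equiv> N (x + a) (y + b + x * \<theta> a)"
  assumes "p \<noteq> 0"
  shows "m\<^sup>2 / \<theta> m * (y / n + (b + a * \<theta> a) / m) / (m * p / n) + a / m
      + \<theta> m * (x / n + b / \<theta> m + y / n * ((\<theta> b + \<theta> a * a\<^sup>2) / \<theta> m)) / (m * p / n) * (\<theta> b / \<theta> m)
    = (x + a) / p"
proof -
  have nz: "n \<noteq> 0" "m \<noteq> 0" "\<theta> m \<noteq> 0" using assms(1,2) by (simp_all add: n_def m_def)
  \<comment> \<open>Assembled from three smaller identities: \<open>1\<close> is the numerator of
    the first coordinate, \<open>2\<close> collects the coefficient of \<open>p\<close>, and
    \<open>3\<close> needs only the sum \<open>n + p\<close>, from which the norm of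
    \<open>(x, y)\<close> drops out.\<close>
  have "m * (y * m + n * (b + a * \<theta> a)) + a * \<theta> m * p
      + \<theta> b * (x * \<theta> m + b * n + y * (\<theta> b + \<theta> a * a\<^sup>2)) = (x + a) * m * \<theta> m"
  proof -
    have 1: "x * \<theta> m + b * n + y * (\<theta> b + \<theta> a * a\<^sup>2) = (y + b + x * \<theta> a) * m + b * p"
      unfolding p_def norm_add n_def[symmetric] m_def theta_norm
      by (simp add: suzuki_norm_def algebra_simps power2_eq_square)
    have 2: "a * \<theta> m + b * \<theta> b = m * (b + a * \<theta> a)"
      unfolding m_def theta_norm by (simp add: suzuki_norm_def algebra_simps power2_eq_square)
    have np: "n + p = m + (x * b + a * y + x * a * \<theta> a)"
      unfolding p_def norm_add n_def m_def by (simp only: add.assoc add_self_left)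
    have 3: "y * m + (n + p) * (b + a * \<theta> a) + \<theta> b * (y + b + x * \<theta> a) = (x + a) * \<theta> m"
      unfolding np m_def theta_norm by (simp add: suzuki_norm_def algebra_simps power2_eq_square)
    have "m * (y * m + n * (b + a * \<theta> a)) + a * \<theta> m * p + \<theta> b * ((y + b + x * \<theta> a) * m + b * p)
        = m * (y * m + n * (b + a * \<theta> a) + \<theta> b * (y + b + x * \<theta> a)) + (a * \<theta> m + b * \<theta> b) * p"
      by (simp only: distrib_left distrib_right ac_simps)
    also have "\<dots> = m * (y * m + (n + p) * (b + a * \<theta> a) + \<theta> b * (y + b + x * \<theta> a))"
      unfolding 2 by (simp only: distrib_left distrib_right ac_simps)
    finally show ?thesis unfolding 1 3 by (simp only: ac_simps)
  qed
  then have "(x + a) / p = (m * (y * m + n * (b + a * \<theta> a)) + a * \<theta> m * p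
      + \<theta> b * (x * \<theta> m + b * n + y * (\<theta> b + \<theta> a * a\<^sup>2))) / (p * m * \<theta> m)"
    using nz \<open>p \<noteq> 0\<close> by simp
  also have "\<dots> = m * (y * m + n * (b + a * \<theta> a)) / (p * m * \<theta> m) + a * \<theta> m * p / (p * m * \<theta> m)
      + \<theta> b * (x * \<theta> m + b * n + y * (\<theta> b + \<theta> a * a\<^sup>2)) / (p * m * \<theta> m)"
    by (simp only: add_divide_distrib)
  also have "m * (y * m + n * (b + a * \<theta> a)) / (p * m * \<theta> m)
      = m\<^sup>2 / \<theta> m * (y / n + (b + a * \<theta> a) / m) / (m * p / n)"
    using nz \<open>p \<noteq> 0\<close> by (simp add: divide_simps del: theta_add) (simp add: algebra_simps power2_eq_square)
  also have "a * \<theta> m * p / (p * m * \<theta> m) = a / m"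
    using nz \<open>p \<noteq> 0\<close> by simp
  also have "\<theta> b * (x * \<theta> m + b * n + y * (\<theta> b + \<theta> a * a\<^sup>2)) / (p * m * \<theta> m)
      = \<theta> m * (x / n + b / \<theta> m + y / n * ((\<theta> b + \<theta> a * a\<^sup>2) / \<theta> m)) / (m * p / n) * (\<theta> b / \<theta> m)"
    using nz \<open>p \<noteq> 0\<close> by (simp add: divide_simps del: theta_add) (simp add: algebra_simps power2_eq_square)?
  finally show ?thesis by (simp only: ac_simps)
qed

end

section \<open>The permutations $\mu_a$ and the Hua subgroup\<close>

locale suzuki = tits_field +
  fixes L :: "'a set"
  assumes zero_in [simp]: "0 \<in> L"
    and one_in [simp]: "1 \<in> L"
    and add_in [simp]: "x \<in> L \<Longrightarrow> y \<in> L \<Longrightarrow> x + y \<in> L"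
    and theta_mult_in [simp]: "x \<in> L \<Longrightarrow> \<theta> c * x \<in> L"
begin

lemma mult_theta_in [simp]: "x \<in> L \<Longrightarrow> x * \<theta> c \<in> L"
  by (subst mult.commute) simp

lemma theta_in: "\<theta> c \<in> L"
  using theta_mult_in[of 1 c] by simp

section \<open>The group U, the involution \<tau> and the translations\<close>

abbreviation U where "U \<equiv> suzuki_group L \<theta>"
abbreviation T where "T \<equiv> suzuki_tau L \<theta>"

lemma carrier_U [simp]: "carrier U = L \<times> L"
  and one_U [simp]: "\<one>\<^bsub>U\<^esub> = (0, 0)"
  and mult_U [simp]: "(a, b) \<otimes>\<^bsub>U\<^esub> (c, d) = (a + c, b + d + a * \<theta> c)"
  by (simp_all add: suzuki_group_def)

lemma group_U: "group U"
proof (rule groupI)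
  fix x assume "x \<in> carrier U"
  then obtain a b where "x = (a, b)" "a \<in> L" "b \<in> L" by auto
  then show "\<exists>y\<in>carrier U. y \<otimes>\<^bsub>U\<^esub> x = \<one>\<^bsub>U\<^esub>"
    by (intro bexI[of _ "(a, b + a * \<theta> a)"]) (auto simp: algebra_simps)
qed (auto simp: algebra_simps)

lemma inv_U [simp]:
  assumes "a \<in> L" "b \<in> L"
  shows "inv\<^bsub>U\<^esub> (a, b) = (a, b + a * \<theta> a)"
  by (rule group.inv_equality[OF group_U]) (use assms in \<open>auto simp: algebra_simps\<close>)

lemma points_U [simp]: "None \<in> points U" "Some (a, b) \<in> points U \<longleftrightarrow> a \<in> L \<and> b \<in> L"
  by (auto simp: points_def)

lemma points_U_cases:
  assumes "x \<in> points U"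
  obtains "x = None" | a b where "x = Some (a, b)" "a \<in> L" "b \<in> L"
  using assms by (auto simp: points_def)

text \<open>One has \<open>1/N = N (1/N)^2\<close>, squares lie in the range of \<theta>, and
  \<open>a N\<close> and \<open>b N\<close> are combinations of \<open>a\<close> and
  \<open>b\<close> with coefficients in that range. Hence \<tau> preserves the set of
  points.\<close>

lemma divide_norm_in [simp]:
  assumes "a \<in> L" "b \<in> L"
  shows "a / N a b \<in> L" "b / N a b \<in> L"
proof -
  have *: "x / N a b = \<theta> (\<theta> (1 / N a b)) * (x * N a b)" for x
    by (simp add: power2_eq_square)
  have "a * N a b = \<theta> (a * \<theta> a + b) * a + \<theta> (\<theta> a) * b"
    "b * N a b = \<theta> (a * \<theta> a + b) * b + \<theta> (\<theta> b) * a"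
    by (simp_all add: suzuki_norm_def algebra_simps power2_eq_square)
  then have "a * N a b \<in> L" "b * N a b \<in> L"
    using assms by (simp_all only: add_in theta_mult_in)
  then show "a / N a b \<in> L" "b / N a b \<in> L"
    unfolding *[of a] *[of b] by (simp_all only: theta_mult_in)
qed

lemma tau_None [simp]: "T None = Some (0, 0)"
  and tau_zero [simp]: "T (Some (0, 0)) = None"
  and tau_Some: "a \<in> L \<Longrightarrow> b \<in> L \<Longrightarrow> a \<noteq> 0 \<or> b \<noteq> 0 \<Longrightarrow>
    T (Some (a, b)) = Some (b / N a b, a / N a b)"
  by (auto simp: suzuki_tau_def)

lemma tau_outside: "x \<notin> points U \<Longrightarrow> T x = x"
  by (auto simp: suzuki_tau_def points_def split: option.split)

lemma tau_closed: "x \<in> points U \<Longrightarrow> T x \<in> points U"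
  by (erule points_U_cases) (auto simp: suzuki_tau_def)

lemma tau_tau [simp]: "T (T x) = x"
proof (cases "x \<in> points U")
  case True
  then show ?thesis
  proof (cases rule: points_U_cases)
    case (2 a b)
    show ?thesis
    proof (cases "a = 0 \<and> b = 0")
      case False
      then have "b / N a b \<noteq> 0 \<or> a / N a b \<noteq> 0" by auto
      moreover have "T (T (Some (a, b))) = T (Some (b / N a b, a / N a b))"
        using 2 False by (simp add: tau_Some)
      ultimately show ?thesis
        using 2 by (simp only: tau_Some divide_norm_in norm_tau) auto
    qed (use 2 in simp)
  qed simp
qed (simp add: tau_outside)

lemma tau_permutes: "T permutes points U"
  by (rule permutes_inverse_pair[of _ _ T]) (auto simp: tau_outside)

lemma inv_tau [simp]: "inv\<^bsub>sym_points U\<^esub> T = T"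
  by (rule sym_right_inv) (auto simp: tau_permutes)

lemma translation_None [simp]: "translation U u None = None"
  and translation_Some [simp]:
    "a \<in> L \<Longrightarrow> b \<in> L \<Longrightarrow> translation U (c, d) (Some (a, b)) = Some (a + c, b + d + a * \<theta> c)"
  by (simp_all add: translation_def)

lemma translation_outside: "x \<notin> points U \<Longrightarrow> translation U u x = x"
  by (auto simp: translation_def points_def split: option.split)

lemma translation_closed:
  "c \<in> L \<Longrightarrow> d \<in> L \<Longrightarrow> x \<in> points U \<Longrightarrow> translation U (c, d) x \<in> points U"
  by (erule points_U_cases) auto

lemma translation_inv_cancel:
  assumes "c \<in> L" "d \<in> L" "x \<in> points U"
  shows "translation U (c, d + c * \<theta> c) (translation U (c, d) x) = x"
  using assms(3) by (rule points_U_cases) (use assms in \<open>auto simp: algebra_simps\<close>)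

section \<open>Diagonal automorphisms of U and their conjugation by \<tau>\<close>

definition hua :: "'a \<Rightarrow> ('a \<times> 'a) option \<Rightarrow> ('a \<times> 'a) option" where
  "hua l x = (case x of None \<Rightarrow> None
    | Some (a, b) \<Rightarrow> if (a, b) \<in> L \<times> L then Some (l * a, l * \<theta> l * b) else Some (a, b))"

lemma hua_None [simp]: "hua l None = None"
  and hua_Some [simp]: "a \<in> L \<Longrightarrow> b \<in> L \<Longrightarrow> hua l (Some (a, b)) = Some (l * a, l * \<theta> l * b)"
  by (simp_all add: hua_def)

lemma hua_outside: "x \<notin> points U \<Longrightarrow> hua l x = x"
  by (auto simp: hua_def points_def split: option.split)

text \<open>The multiplicative group of the subfield \<open>k\<close>. As \<open>L\<close> is a
  \<open>k\<close>-space, these factors keep \<open>hua\<close> inside the set of points.\<close>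

definition scalars where "scalars = range \<theta> - {0}"

lemma scalars_mult: "l \<in> scalars \<Longrightarrow> l' \<in> scalars \<Longrightarrow> l * l' \<in> scalars"
  unfolding scalars_def by (auto simp flip: theta_mult)

lemma scalars_inverse: "l \<in> scalars \<Longrightarrow> 1 / l \<in> scalars"
  unfolding scalars_def by (auto simp: image_iff) (metis theta_divide theta_one)

lemma scalars_mult_in:
  assumes "l \<in> scalars" "a \<in> L"
  shows "l * a \<in> L" "l * \<theta> l * a \<in> L"
proof -
  obtain c where c: "l = \<theta> c" using assms(1) by (auto simp: scalars_def)
  then show "l * a \<in> L" using assms(2) by simp
  have "l * \<theta> l * a = \<theta> (c * \<theta> c) * a" unfolding c by (simp only: theta_mult)
  then show "l * \<theta> l * a \<in> L" using assms(2) by (simp only: theta_mult_in)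
qed

text \<open>The power \<open>N^(2-\<theta>)\<close> is the image of \<open>N^(\<theta>-1)\<close>
  under \<theta>.\<close>

lemma mu_factor_in_scalars: "a \<noteq> 0 \<or> b \<noteq> 0 \<Longrightarrow> mu_factor a b \<in> scalars"
proof -
  have "mu_factor a b = \<theta> (\<theta> (N a b) / N a b)"
    unfolding mu_factor_def theta_divide theta_theta ..
  then show "a \<noteq> 0 \<or> b \<noteq> 0 \<Longrightarrow> ?thesis"
    unfolding scalars_def by (auto simp: mu_factor_def simp del: theta_divide)
qed

lemma hua_one: "hua 1 = id"
proof
  fix x show "hua 1 x = id x"
    by (cases "x \<in> points U") (auto elim: points_U_cases simp: hua_outside)
qed

lemma hua_hua:
  assumes "l \<in> scalars"
  shows "hua l' \<circ> hua l = hua (l' * l)"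
proof
  fix x show "(hua l' \<circ> hua l) x = hua (l' * l) x"
  proof (cases "x \<in> points U")
    case True
    then show ?thesis
    proof (cases rule: points_U_cases)
      case (2 a b)
      then have "(hua l' \<circ> hua l) x = Some (l' * (l * a), l' * \<theta> l' * (l * \<theta> l * b))"
        using scalars_mult_in[OF assms] by simp
      then show ?thesis using 2 by (simp add: ac_simps)
    qed simp
  qed (simp add: hua_outside)
qed

lemma hua_permutes:
  assumes "l \<in> scalars"
  shows "hua l permutes points U"
proof (rule permutes_inverse_pair)
  show "hua l \<circ> hua (1 / l) = id" "hua (1 / l) \<circ> hua l = id"
    using assms scalars_inverse[OF assms]
    by (simp_all add: hua_hua) (simp_all add: scalars_def hua_one)
qed (simp add: hua_outside)

text \<open>The involution swaps the coordinates and divides by the norm, which \<open>hua l\<close>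
  scales by \<open>l^(2+\<theta>)\<close>. So the factors \<open>l^(1+\<theta>)\<close> and
  \<open>l\<close> turn into \<open>l^(-1)\<close> and \<open>l^(-1-\<theta>)\<close>.\<close>

lemma tau_hua_tau:
  assumes l: "l \<in> scalars"
  shows "T \<circ> hua l \<circ> T = hua (1 / l)"
proof
  fix x show "(T \<circ> hua l \<circ> T) x = hua (1 / l) x"
  proof (cases "x \<in> points U")
    case True
    then show ?thesis
    proof (cases rule: points_U_cases)
      case (2 a b)
      show ?thesis
      proof (cases "a = 0 \<and> b = 0")
        case False
        define n where "n = N a b"
        have nz: "l \<noteq> 0" "n \<noteq> 0" using l False by (auto simp: scalars_def n_def)
        have n: "N (l * (b / n)) (l * \<theta> l * (a / n)) = l\<^sup>2 * \<theta> l / n"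
          unfolding norm_scale n_def norm_tau by simp
        have "(T \<circ> hua l \<circ> T) x = T (Some (l * (b / n), l * \<theta> l * (a / n)))"
          using 2 False by (simp add: tau_Some n_def)
        also have "\<dots> = Some (l * \<theta> l * (a / n) / (l\<^sup>2 * \<theta> l / n), l * (b / n) / (l\<^sup>2 * \<theta> l / n))"
        proof -
          have "l * (b / n) \<noteq> 0 \<or> l * \<theta> l * (a / n) \<noteq> 0" using False nz by auto
          then show ?thesis
            using 2 scalars_mult_in[OF l] divide_norm_in[of a b] by (simp only: tau_Some n[unfolded n_def] n_def)
        qed
        also have "\<dots> = Some (1 / l * a, 1 / l * \<theta> (1 / l) * b)"
          using nz by (simp add: field_simps power2_eq_square)
        finally show ?thesis using 2 by simp
      qed (use 2 in simp)
    qed simp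
  qed (simp add: tau_outside hua_outside)
qed

text \<open>
  This is $\tau\alpha_u\tau = \alpha_{-((-u)\tau)}\, h\, \tau\, \alpha_{u\tau}$ for \<open>u = (a, b)\<close>, with products
  applied from left to right and \<open>h\<close> the Hua automorphism of factor \<open>mu_factor a b\<close>; the formula
  for $\mu_u$ follows by cancelling translations.
\<close>

lemma tau_translation_tau:
  assumes L: "a \<in> L" "b \<in> L" and nz: "a \<noteq> 0 \<or> b \<noteq> 0" and z: "z \<in> points U"
  defines "m \<equiv> N a b" and "c \<equiv> (b + a * \<theta> a) / N a b"
  shows "T (translation U (a, b) (T z))
    = translation U (b / m, a / m) (T (hua (mu_factor a b) (translation U (c, a / m + c * \<theta> c) z)))"
  using z
proof (cases rule: points_U_cases)
  case 1
  then show ?thesis using L nz by (simp add: tau_Some m_def)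
next
  case (2 z1 z2)
  have m: "m \<noteq> 0" "\<theta> m \<noteq> 0" using nz by (simp_all add: m_def)
  have f: "mu_factor a b = m\<^sup>2 / \<theta> m" "mu_factor a b * \<theta> (mu_factor a b) = \<theta> m"
    using mu_factor_mult_theta[of a b] by (simp_all add: m_def mu_factor_def)
  have c: "c \<in> L" "a / m \<in> L" "b / m \<in> L"
    using divide_norm_in[of a "b + a * \<theta> a"] L by (simp_all add: c_def m_def)
  have fs: "mu_factor a b \<in> scalars" using mu_factor_in_scalars nz .
  \<comment> \<open>In exponents, \<open>(2-\<theta>)(2+\<theta>) = 4 - 2 = 2\<close>.\<close>
  have sc: "N (mu_factor a b * x) (\<theta> m * y) = m\<^sup>2 * N x y" for x y
  proof -
    have "(mu_factor a b)\<^sup>2 * \<theta> (mu_factor a b) = mu_factor a b * \<theta> m"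
      by (simp only: power2_eq_square mult.assoc f(2))
    then show ?thesis
      using norm_scale[of "mu_factor a b" x y] m by (simp only: f(2)) (simp add: f(1))
  qed
  have second: "a / m + c * \<theta> c = b / \<theta> m"
    unfolding c_def m_def using nz by (rule tau_neg_second)
  have s2: "b / \<theta> m \<in> L" using c by (simp only: second[symmetric] add_in mult_theta_in)
  have theta_c: "\<theta> c = (\<theta> b + \<theta> a * a\<^sup>2) / \<theta> m"
    by (simp add: c_def m_def)
  show ?thesis
  proof (cases "z1 = 0 \<and> z2 = 0")
    \<comment> \<open>For \<open>z = 0\<close> the left side is 0, because \<open>z\<tau>\<close> is
      infinity and translations fix it. On the right the point before the last translation turns out
      to be \<open>-(u\<tau>)\<close>.\<close>
    case True
    have "N (mu_factor a b * c) (\<theta> m * (b / \<theta> m)) = m"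
    proof -
      have "N c (b / \<theta> m) = 1 / m"
        unfolding second[symmetric] norm_neg
        using norm_tau[of "b + a * \<theta> a" a] unfolding c_def m_def norm_neg .
      then show ?thesis unfolding sc using m by (simp add: power2_eq_square)
    qed
    moreover have "mu_factor a b * c = m * (b + a * \<theta> a) / \<theta> m"
      unfolding f(1) c_def m_def[symmetric] using m by (simp add: power2_eq_square)
    moreover have "mu_factor a b * c \<noteq> 0 \<or> \<theta> m * (b / \<theta> m) \<noteq> 0"
      using nz m fs by (auto simp: c_def m_def scalars_def)
    moreover have "mu_factor a b * c \<in> L" "\<theta> m * (b / \<theta> m) \<in> L"
      using scalars_mult_in[OF fs] c(1) L m by auto
    ultimately have "T (hua (mu_factor a b) (Some (c, b / \<theta> m))) = Some (b / m, (b + a * \<theta> a) / \<theta> m)"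
      using c(1) s2 m by (simp only: hua_Some f(2) tau_Some) simp
    moreover have "(b + a * \<theta> a) / \<theta> m + a / m + b / m * \<theta> (b / m) = 0"
    proof -
      have "(b + a * \<theta> a) * m + a * \<theta> m + b * \<theta> b = 0"
        unfolding m_def theta_norm by (simp add: suzuki_norm_def algebra_simps power2_eq_square)
      then have "((b + a * \<theta> a) * m + a * \<theta> m + b * \<theta> b) / (m * \<theta> m) = 0" by simp
      then show ?thesis using m
        by (simp only: add_divide_distrib) (simp add: add_divide_distrib)
    qed
    moreover have "b / m \<in> L" "(b + a * \<theta> a) / \<theta> m \<in> L"
      using c L m theta_mult_in[of _ "1 / m"] by (simp_all only: theta_divide theta_one) auto
    ultimately show ?thesis
      using True 2 L c s2 by (simp add: second)
  next
    case False
    obtain x y where xy: "T z = Some (x, y)" "x \<in> L" "y \<in> L"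
      using 2 False divide_norm_in[of z1 z2] by (simp add: tau_Some)
    define n where "n = N x y"
    \<comment> \<open>The point \<open>w = (x, y)\<close> has the finite image \<open>z\<close>
      under \<tau>, so it is not 0.\<close>
    have xy0: "x \<noteq> 0 \<or> y \<noteq> 0"
      using xy(1) 2 tau_tau[of z] by (metis option.distinct(1) tau_zero)
    then have n: "n \<noteq> 0" by (simp add: n_def)
    have z: "z = Some (y / n, x / n)"
      using tau_tau[of z] unfolding xy(1) tau_Some[OF xy(2,3) xy0] n_def[symmetric] by simp
    have zL: "y / n \<in> L" "x / n \<in> L" using z 2 by simp_all
    define p where "p = N (x + a) (y + b + x * \<theta> a)"
    show ?thesis
    proof (cases "p = 0")
      \<comment> \<open>Here \<open>w = -u\<close>, and on both sides \<tau> is applied to 0, so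
        both are infinity.\<close>
      case True
      then have "x = a" "y + b + x * \<theta> a = 0"
        unfolding p_def by (auto simp: eq_iff_add_eq_zero[of x a])
      then have "y = b + a * \<theta> a" by (simp add: eq_iff_add_eq_zero[of y] add.assoc)
      then have "n = m" unfolding n_def m_def \<open>x = a\<close> by (simp only: norm_neg)
      then have "y / n = c" using \<open>y = b + a * \<theta> a\<close> by (simp add: c_def m_def)
      have "translation U (c, a / m + c * \<theta> c) z = Some (0, 0)"
        using zL by (simp add: z \<open>n = m\<close> \<open>y / n = c\<close>[unfolded \<open>n = m\<close>] \<open>x = a\<close> ac_simps del: theta_divide)
      moreover have "translation U (a, b) (T z) = Some (0, 0)"
        using xy L True by (simp add: p_def)
      ultimately show ?thesis by simp
    next
      case False
      \<comment> \<open>These are the coordinates of \<open>w\<tau> - (-u)\<tau>\<close>.\<close>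
      define P Q where "P = y / n + c" and "Q = x / n + (a / m + c * \<theta> c) + y / n * \<theta> c"
      have PQ: "translation U (c, a / m + c * \<theta> c) z = Some (P, Q)"
        using zL by (simp add: z P_def Q_def del: theta_divide)
      have L': "P \<in> L" "Q \<in> L"
        unfolding P_def Q_def using zL c by (simp_all only: add_in mult_theta_in)
      have "N P Q = p / (n * m)"
        unfolding P_def Q_def n_def m_def c_def p_def by (rule norm_tau_add[OF nz xy0])
      then have NPQ: "N (mu_factor a b * P) (\<theta> m * Q) = m * p / n"
        unfolding sc using m n by (simp add: power2_eq_square)
      then have nz': "mu_factor a b * P \<noteq> 0 \<or> \<theta> m * Q \<noteq> 0"
        using m n False norm_eq_zero_iff by (metis divide_eq_0_iff mult_eq_0_iff)
      have L'': "mu_factor a b * P \<in> L" "\<theta> m * Q \<in> L"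
        using scalars_mult_in[OF fs] L' by simp_all
      have T: "T (hua (mu_factor a b) (Some (P, Q)))
          = Some (\<theta> m * Q / (m * p / n), mu_factor a b * P / (m * p / n))"
        using L' L'' nz' by (simp only: hua_Some f(2) tau_Some NPQ)
      have L3: "\<theta> m * Q / (m * p / n) \<in> L" "mu_factor a b * P / (m * p / n) \<in> L"
        using divide_norm_in[OF L''] unfolding NPQ by simp_all
      have Q: "Q = x / n + b / \<theta> m + y / n * ((\<theta> b + \<theta> a * a\<^sup>2) / \<theta> m)"
        unfolding Q_def second unfolding theta_c ..
      have P: "P = y / n + (b + a * \<theta> a) / m" by (simp add: P_def c_def m_def)
      have "\<theta> m * Q / (m * p / n) + b / m = (y + b + x * \<theta> a) / p"
        using tau_add_first[OF nz xy0] False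
        unfolding n_def[symmetric] m_def[symmetric] p_def[symmetric] Q by blast
      moreover have "mu_factor a b * P / (m * p / n) + a / m
          + \<theta> m * Q / (m * p / n) * (\<theta> b / \<theta> m) = (x + a) / p"
        using tau_add_second[OF nz xy0] False
        unfolding n_def[symmetric] m_def[symmetric] p_def[symmetric] P Q f(1) by blast
      moreover have "T (Some (x + a, y + b + x * \<theta> a)) = Some ((y + b + x * \<theta> a) / p, (x + a) / p)"
        unfolding p_def
      proof (rule tau_Some)
        show "x + a \<noteq> 0 \<or> y + b + x * \<theta> a \<noteq> 0"
          using False unfolding p_def norm_eq_zero_iff by blast
      qed (use xy L in simp_all)
      ultimately show ?thesis
        using xy L L3 unfolding PQ T by (simp only: translation_Some theta_divide)
    qed
  qed
qed

text \<open>Read from left to right, \<mu> is \<tau>, translation by \<open>(-u)\<tau>\<close>, the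
  product \<open>\<tau> \<alpha>_u \<tau>\<close>, translation by \<open>-(u\<tau>)\<close>, and
  \<tau>. Rewriting the middle product by \<open>tau_translation_tau\<close> cancels both outer
  translations and leaves \<tau> followed by \<open>h\<close>.\<close>

lemma mu_eq:
  assumes L: "a \<in> L" "b \<in> L" and nz: "a \<noteq> 0 \<or> b \<noteq> 0"
  shows "mu U T (a, b) = hua (mu_factor a b) \<circ> T"
proof
  define m where "m = N a b"
  define c where "c = (b + a * \<theta> a) / m"
  let ?A = "translation U (c, a / m)" and ?B = "translation U (b / m, a / m + b / m * \<theta> (b / m))"
  have in_L: "c \<in> L" "a / m \<in> L" "b / m \<in> L"
    using divide_norm_in[of a "b + a * \<theta> a"] L by (simp_all add: c_def m_def)
  have "b + a * \<theta> a \<noteq> 0 \<or> a \<noteq> 0" using nz by auto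
  then have "act (inv\<^bsub>U\<^esub> (a, b)) T = (c, a / m)" "act (a, b) T = (b / m, a / m)"
    using L nz by (auto simp: act_def tau_Some c_def m_def)
  then have mu: "mu U T (a, b) x = T (?B (T (translation U (a, b) (T (?A (T x))))))" for x
    using in_L by (simp add: mu_def conjugate_def sym_right_mult del: theta_divide)
  fix x
  show "mu U T (a, b) x = (hua (mu_factor a b) \<circ> T) x"
  proof (cases "x \<in> points U")
    case True
    define z where "z = ?A (T x)"
    have z: "z \<in> points U"
      unfolding z_def using translation_closed in_L True tau_closed by blast
    have "translation U (c, a / m + c * \<theta> c) z = T x"
      unfolding z_def using translation_inv_cancel[OF in_L(1,2) tau_closed[OF True]] .
    then have "T (translation U (a, b) (T z)) = translation U (b / m, a / m) (T (hua (mu_factor a b) (T x)))"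
      using tau_translation_tau[OF L nz z] by (simp add: c_def m_def)
    moreover have "T (hua (mu_factor a b) (T x)) \<in> points U"
      using True tau_closed permutes_in_image[OF hua_permutes] mu_factor_in_scalars[OF nz] by blast
    ultimately show ?thesis
      using translation_inv_cancel[OF in_L(3,2)] unfolding mu z_def[symmetric] by simp
  qed (simp add: mu tau_outside translation_outside hua_outside)
qed

text \<open>The product is \<open>\<tau> h_a \<tau> h_b\<close> from left to right, and conjugation
  by \<tau> inverts the factor of \<open>h_a\<close>.\<close>

lemma mu_mult_mu:
  assumes "a \<in> nonid U" "b \<in> nonid U"
  shows "mu U T a \<otimes>\<^bsub>sym_points U\<^esub> mu U T b
    = hua (case_prod mu_factor b / case_prod mu_factor a)"
    "case_prod mu_factor b / case_prod mu_factor a \<in> scalars"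
proof -
  obtain a1 a2 b1 b2 where ab: "a = (a1, a2)" "b = (b1, b2)" "a1 \<in> L" "a2 \<in> L" "b1 \<in> L" "b2 \<in> L"
    "a1 \<noteq> 0 \<or> a2 \<noteq> 0" "b1 \<noteq> 0 \<or> b2 \<noteq> 0"
    using assms by (auto simp: nonid_def)
  have f: "mu_factor a1 a2 \<in> scalars" "mu_factor b1 b2 \<in> scalars" using ab mu_factor_in_scalars by auto
  show "case_prod mu_factor b / case_prod mu_factor a \<in> scalars"
    using scalars_mult[OF f(2) scalars_inverse[OF f(1)]] by (simp add: ab)
  have "mu U T a \<otimes>\<^bsub>sym_points U\<^esub> mu U T b
      = hua (mu_factor b1 b2) \<circ> (T \<circ> hua (mu_factor a1 a2) \<circ> T)"
    unfolding sym_right_mult using ab by (simp add: mu_eq o_assoc)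
  also have "\<dots> = hua (mu_factor b1 b2 / mu_factor a1 a2)"
    unfolding tau_hua_tau[OF f(1)] using hua_hua[OF scalars_inverse[OF f(1)]] by simp
  finally show "mu U T a \<otimes>\<^bsub>sym_points U\<^esub> mu U T b
    = hua (case_prod mu_factor b / case_prod mu_factor a)" by (simp add: ab)
qed

text \<open>The generators are diagonal with factors in the group \<open>scalars\<close>, and
  products and inverses stay of this form. This bounds the orbits of the Hua subgroup on the
  center.\<close>

lemma hua_subgroup_subset: "hua_subgroup U T \<subseteq> hua ` scalars"
proof
  fix h assume "h \<in> hua_subgroup U T"
  then show "h \<in> hua ` scalars"
    unfolding hua_subgroup_def
  proof (induction rule: generate.induct)
    case one
    have "1 \<in> scalars" unfolding scalars_def by (metis DiffI rangeI singletonD theta_one zero_neq_one)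
    then show ?case using hua_one by (metis image_eqI monoid.select_convs(2) sym_right_def)
  next
    case (incl h)
    show ?case using incl mu_mult_mu by auto
  next
    case (inv h)
    then obtain l where "h = hua l" "l \<in> scalars" using mu_mult_mu by blast
    moreover have "inv\<^bsub>sym_points U\<^esub> hua l = hua (1 / l)" if "l \<in> scalars" for l
      using that scalars_inverse[OF that]
      by (intro sym_right_inv) (simp_all add: hua_permutes hua_hua, simp add: scalars_def hua_one)
    ultimately show ?case using scalars_inverse by auto
  next
    case (eng h1 h2)
    then obtain l1 l2 where l: "h1 = hua l1" "h2 = hua l2" "l1 \<in> scalars" "l2 \<in> scalars" by blast
    then have "h1 \<otimes>\<^bsub>sym_points U\<^esub> h2 = hua (l2 * l1)" unfolding sym_right_mult by (simp only: hua_hua)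
    then show ?case using scalars_mult l(3,4) by blast
  qed
qed

lemma tilde_central:
  assumes "t \<in> L" "t \<noteq> 0"
  shows "tilde U T (0, t) = (\<theta> t / t, t)"
proof -
  \<comment> \<open>Chosen so that \<open>(0, t)\<tau> = (s, 0)\<close>.\<close>
  define s where "s = t / \<theta> t"
  have nz: "\<theta> t \<noteq> 0" "s \<noteq> 0" using assms by (simp_all add: s_def)
  have s: "s \<in> L" using divide_norm_in(2)[of 0 t] assms by (simp add: s_def norm_zero_left)
  \<comment> \<open>This is the norm of \<open>-(s, 0)\<close>, hence that of
    \<open>(0, t)\<tau>\<close>, the inverse of \<open>N 0 t\<close>.\<close>
  have sN: "N s (s * \<theta> s) = 1 / \<theta> t"
    using nz assms by (simp add: suzuki_norm_def s_def field_simps power2_eq_square)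
  have "tilde U T (0, t) = act (inv\<^bsub>U\<^esub> (s, 0)) T"
    using assms by (simp add: tilde_def act_def tau_Some norm_zero_left s_def)
  also have "\<dots> = (s * \<theta> s / (1 / \<theta> t), s / (1 / \<theta> t))"
    using s nz by (simp add: act_def tau_Some sN del: divide_divide_eq_right)
  also have "\<dots> = (\<theta> t / t, t)"
    using assms nz by (simp add: s_def field_simps power2_eq_square)
  finally show ?thesis .
qed

end

section \<open>The equivalences\<close>

text \<open>The assumption \<open>nontrivial\<close> excludes the field with two elements, over
  which U is abelian.\<close>

locale proper_suzuki = suzuki +
  assumes nontrivial: "\<exists>x::'a. x \<noteq> 0 \<and> x \<noteq> 1"
    and generates: "generate_ring field_rec (range \<theta> \<union> L) = UNIV"
begin

text \<open>The range of \<theta> is a subring; once it contains \<open>L\<close>, it contains the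
  ring generated by \<open>k\<close> and \<open>L\<close>, which is the whole field.\<close>

lemma surj_if_subset:
  assumes "L \<subseteq> range \<theta>"
  shows "surj \<theta>"
proof -
  have "x \<in> range \<theta>" if "x \<in> generate_ring field_rec (range \<theta> \<union> L)" for x
    using that
  proof induction
    case one
    show ?case by (metis rangeI theta_one ring_of_type_algebra_def monoid.select_convs(2))
  next
    \<comment> \<open>In characteristic 2 negation is the identity.\<close>
    case (a_inv h)
    have "\<ominus>\<^bsub>field_rec\<^esub> h = h"
      by (rule abelian_group.minus_equality[OF ring.is_abelian_group[OF ring_from_type_algebra]]) (simp_all add: ring_of_type_algebra_def)
    with a_inv show ?case by simp
  qed (use assms in \<open>auto simp: ring_of_type_algebra_def simp flip: theta_add theta_mult\<close>)
  then show ?thesis unfolding generates by blast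
qed

lemma L_eq_UNIV: "surj \<theta> \<Longrightarrow> L = UNIV"
  using theta_in by (metis UNIV_eq_I surj_def)

section \<open>The center and the parts of a Suzuki partition\<close>

text \<open>Let \<open>(a, b)\<close> be central with \<open>a\<close> nonzero. Commuting with
  \<open>(1, 0)\<close> gives \<open>\<theta> a = a\<close>, and commuting with all
  \<open>(c, 0)\<close> then shows that \<theta> fixes \<open>L\<close> pointwise. As
  \<open>L\<close> contains the range of \<theta>, injectivity makes \<theta> the identity, so every
  \<open>x\<close> satisfies \<open>x^2 = x\<close>, against \<open>nontrivial\<close>.\<close>

lemma center_U: "center U = {0} \<times> L"
proof
  show "{0} \<times> L \<subseteq> center U"
    by (auto simp: center_def ac_simps)
  show "center U \<subseteq> {0} \<times> L"
  proof
    fix z assume z: "z \<in> center U"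
    then obtain a b where ab: "z = (a, b)" "a \<in> L" "b \<in> L" by (auto simp: center_def)
    have comm: "a * \<theta> c = c * \<theta> a" if "c \<in> L" for c
    proof -
      have "z \<otimes>\<^bsub>U\<^esub> (c, 0) = (c, 0) \<otimes>\<^bsub>U\<^esub> z" using z that by (auto simp: center_def)
      then show ?thesis by (simp add: ab(1))
    qed
    have "a = 0"
    proof (rule ccontr)
      assume "a \<noteq> 0"
      have "a = \<theta> a" using comm[of 1] by simp
      then have fix_L: "\<theta> c = c" if "c \<in> L" for c
        using comm[OF that] \<open>a \<noteq> 0\<close> by (simp add: mult.commute)
      have "x = 0 \<or> x = 1" for x :: 'a
      proof -
        have "\<theta> x = x" using fix_L[OF theta_in] by (metis theta_eq_iff)
        then have "x * x = x" by (metis theta_theta power2_eq_square)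
        then show ?thesis by simp
      qed
      then show False using nontrivial by blast
    qed
    with ab show "z \<in> {0} \<times> L" by simp
  qed
qed

lemma center_nonzero: "center U - {\<one>\<^bsub>U\<^esub>} = {(0, t) | t. t \<in> L \<and> t \<noteq> 0}"
  by (auto simp: center_U)

text \<open>In exponents, \<open>(1+\<theta>)(\<theta>-1) = 2 - 1 = 1\<close>.\<close>

lemma ratio_inverse: "r \<noteq> 0 \<Longrightarrow> \<theta> (r * \<theta> r) / (r * \<theta> r) = r"
  by (simp add: power2_eq_square)

lemma ratio:
  assumes "t \<in> L" "t \<noteq> 0"
  shows "\<theta> t / t \<in> L" "\<theta> t / t * \<theta> (\<theta> t / t) = t"
proof -
  \<comment> \<open>Written as an element of \<open>k\<close> times \<open>t\<close>, using
    \<open>1/t = t (1/t)^2\<close>.\<close>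
  have "\<theta> t / t = \<theta> (t * \<theta> (1 / t)) * t"
    using assms by (simp add: power2_eq_square)
  then show "\<theta> t / t \<in> L" using assms by (simp only: theta_mult_in)
  show "\<theta> t / t * \<theta> (\<theta> t / t) = t"
    using assms by (simp add: power2_eq_square)
qed

text \<open>The substitution \<open>t = r\<^bsup>1+\<theta>\<^esup>\<close>, inverted by \<open>r = t\<^bsup>\<theta>-1\<^esup>\<close>, makes the map \<open>\<sim>\<close> polynomial on the center.\<close>

lemma center_nonzero_param:
  "center U - {\<one>\<^bsub>U\<^esub>} = (\<lambda>r. (0, r * \<theta> r)) ` (L - {0})" (is "_ = ?R")
proof
  show "?R \<subseteq> center U - {\<one>\<^bsub>U\<^esub>}" unfolding center_nonzero by auto
  show "center U - {\<one>\<^bsub>U\<^esub>} \<subseteq> ?R"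
  proof
    fix z assume "z \<in> center U - {\<one>\<^bsub>U\<^esub>}"
    then obtain t where t: "z = (0, t)" "t \<in> L" "t \<noteq> 0" unfolding center_nonzero by blast
    show "z \<in> ?R"
      by (rule image_eqI[of _ _ "\<theta> t / t"]) (use t ratio in auto)
  qed
qed

lemma tilde_param:
  assumes "r \<in> L" "r \<noteq> 0"
  shows "tilde U T (0, r * \<theta> r) = (r, r * \<theta> r)"
  using tilde_central[of "r * \<theta> r"] assms ratio_inverse by simp

lemma inj_param: "inj_on (\<lambda>r. (0 :: 'a, r * \<theta> r)) (L - {0})"
  by (rule inj_onI) (metis DiffD2 Pair_inject ratio_inverse singletonI)

text \<open>In the parameter \<open>r\<close> the element \<open>\<sim>a\<close> is
  \<open>(r, r \<theta>(r))\<close>, whose negative is \<open>(r, 0)\<close>; adding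
  \<open>(s, s \<theta>(s))\<close> to the latter gives the fourth part.\<close>

lemma suzuki_parts:
  defines "Z' \<equiv> center U - {\<one>\<^bsub>U\<^esub>}"
  shows "{tilde U T a | a. a \<in> Z'} = {(r, r * \<theta> r) | r. r \<in> L \<and> r \<noteq> 0}"
    and "{inv\<^bsub>U\<^esub> (tilde U T a) | a. a \<in> Z'} = {(r, 0) | r. r \<in> L \<and> r \<noteq> 0}"
    and "{inv\<^bsub>U\<^esub> (tilde U T a) \<otimes>\<^bsub>U\<^esub> tilde U T b | a b. a \<in> Z' \<and> b \<in> Z' \<and> a \<noteq> b}
      = {(r + s, (r + s) * \<theta> s) | r s. r \<in> L \<and> s \<in> L \<and> r \<noteq> 0 \<and> s \<noteq> 0 \<and> r \<noteq> s}"
proof -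
  show "{tilde U T a | a. a \<in> Z'} = {(r, r * \<theta> r) | r. r \<in> L \<and> r \<noteq> 0}"
    unfolding Z'_def center_nonzero_param image_comprehension
    using tilde_param by (simp cong: rev_conj_cong)
  have inv: "inv\<^bsub>U\<^esub> (tilde U T (0, r * \<theta> r)) = (r, 0)" if "r \<in> L" "r \<noteq> 0" for r
    using that by (simp add: tilde_param)
  show "{inv\<^bsub>U\<^esub> (tilde U T a) | a. a \<in> Z'} = {(r, 0) | r. r \<in> L \<and> r \<noteq> 0}"
    unfolding Z'_def center_nonzero_param image_comprehension
    using inv by (simp cong: rev_conj_cong)
  have prod: "inv\<^bsub>U\<^esub> (tilde U T (0, r * \<theta> r)) \<otimes>\<^bsub>U\<^esub> tilde U T (0, s * \<theta> s) = (r + s, (r + s) * \<theta> s)"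
    if "r \<in> L" "r \<noteq> 0" "s \<in> L" "s \<noteq> 0" for r s
    using that by (simp add: inv tilde_param algebra_simps)
  have "{inv\<^bsub>U\<^esub> (tilde U T a) \<otimes>\<^bsub>U\<^esub> tilde U T b | a b. a \<in> Z' \<and> b \<in> Z' \<and> a \<noteq> b}
      = {inv\<^bsub>U\<^esub> (tilde U T (0, r * \<theta> r)) \<otimes>\<^bsub>U\<^esub> tilde U T (0, s * \<theta> s) | r s.
          r \<in> L \<and> s \<in> L \<and> r \<noteq> 0 \<and> s \<noteq> 0 \<and> r \<noteq> s}"
    unfolding Z'_def center_nonzero_param pairs_image[OF inj_param] by (auto 0 4)
  also have "\<dots> = {(r + s, (r + s) * \<theta> s) | r s. r \<in> L \<and> s \<in> L \<and> r \<noteq> 0 \<and> s \<noteq> 0 \<and> r \<noteq> s}"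
    using prod by (simp cong: rev_conj_cong)
  finally show "{inv\<^bsub>U\<^esub> (tilde U T a) \<otimes>\<^bsub>U\<^esub> tilde U T b | a b. a \<in> Z' \<and> b \<in> Z' \<and> a \<noteq> b}
      = {(r + s, (r + s) * \<theta> s) | r s. r \<in> L \<and> s \<in> L \<and> r \<noteq> 0 \<and> s \<noteq> 0 \<and> r \<noteq> s}" .
qed

section \<open>Suzuki partitions and surjectivity\<close>

text \<open>Locate \<open>(1, d)\<close> in the four parts: it is not central, and the other parts
  give \<open>d = 1\<close>, \<open>d = 0\<close> or \<open>d = \<theta> s\<close>. Each lies in the
  range of \<theta>.\<close>

lemma surj_if_suzuki_partition:
  assumes "has_suzuki_partition U T"
  shows "surj \<theta>"
proof (rule surj_if_subset, rule subsetI)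
  fix d assume "d \<in> L"
  then have "(1, d) \<in> carrier U" by simp
  then have "(1, d) \<in> {0} \<times> L \<union> {(r, r * \<theta> r) | r. r \<in> L \<and> r \<noteq> 0} \<union> {(r, 0) | r. r \<in> L \<and> r \<noteq> 0}
      \<union> {(r + s, (r + s) * \<theta> s) | r s. r \<in> L \<and> s \<in> L \<and> r \<noteq> 0 \<and> s \<noteq> 0 \<and> r \<noteq> s}"
    using assms unfolding has_suzuki_partition_def Let_def suzuki_parts partition_on_def
    unfolding center_U by (simp add: Un_assoc)
  then consider "d = 1" | "d = 0" | s where "d = \<theta> s"
    by (auto simp: eq_commute[of 1])
  then show "d \<in> range \<theta>"
    by cases (metis rangeI theta_one, metis rangeI theta_zero, blast)
qed

text \<open>A noncentral element is \<open>(c, c \<theta>(s))\<close> for exactly one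
  \<open>s\<close>. The cases \<open>s = c\<close>, \<open>s = 0\<close> and all other
  \<open>s\<close> give the three noncentral parts.\<close>

lemma suzuki_partition_if_surj:
  assumes surj: "surj \<theta>"
  shows "has_suzuki_partition U T"
proof -
  have L: "L = UNIV" using surj by (rule L_eq_UNIV)
  define A where "A = {0 :: 'a} \<times> (UNIV :: 'a set)"
  define B where "B = {(r, r * \<theta> r) | r. r \<noteq> 0}"
  define C where "C = {(r, 0 :: 'a) | r :: 'a. r \<noteq> 0}"
  define D where "D = {(r + s, (r + s) * \<theta> s) | r s. r \<noteq> 0 \<and> s \<noteq> 0 \<and> r \<noteq> s}"
  have D: "D = {(c, c * \<theta> s) | c s. c \<noteq> 0 \<and> s \<noteq> 0 \<and> s \<noteq> c}" (is "_ = ?D")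
  proof
    show "D \<subseteq> ?D" unfolding D_def by (auto simp flip: eq_iff_add_eq_zero)
    show "?D \<subseteq> D"
    proof
      fix z assume "z \<in> ?D"
      then obtain c s where z: "z = (c, c * \<theta> s)" "c \<noteq> 0" "s \<noteq> 0" "s \<noteq> c" by blast
      \<comment> \<open>The witness is \<open>r = c + s\<close>: it is nonzero because
        \<open>s \<noteq> c\<close>, and differs from \<open>s\<close> because
        \<open>c \<noteq> 0\<close>.\<close>
      moreover have "c + s \<noteq> 0" using z by (metis eq_iff_add_eq_zero)
      ultimately show "z \<in> D"
        unfolding D_def mem_Collect_eq
        by (intro exI[of _ "c + s"] exI[of _ s]) (simp add: add.assoc)
    qed
  qed
  have "z \<in> A \<union> B \<union> C \<union> D" for z
  proof (cases "fst z = 0")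
    case True
    then show ?thesis by (cases z) (simp add: A_def)
  next
    case False
    obtain s where s: "\<theta> s = snd z / fst z" using surj by (metis surjD)
    have z: "z = (fst z, fst z * \<theta> s)" using False by (simp add: s)
    consider "s = 0" | "s = fst z" | "s \<noteq> 0" "s \<noteq> fst z" by blast
    then show ?thesis
    proof cases
      case 1
      with z False have "z \<in> C" unfolding C_def by (metis (mono_tags, lifting) mem_Collect_eq mult_zero_right theta_zero)
      then show ?thesis by simp
    next
      case 2
      with z False have "z \<in> B" unfolding B_def by (metis (mono_tags, lifting) mem_Collect_eq)
      then show ?thesis by simp
    next
      case 3
      with z False have "z \<in> D" unfolding D by (metis (mono_tags, lifting) mem_Collect_eq)
      then show ?thesis by simp
    qed
  qed
  then have union: "A \<union> B \<union> C \<union> D = UNIV" by blast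
  have disj: "A \<inter> B = {}" "A \<inter> C = {}" "A \<inter> D = {}" "B \<inter> C = {}" "B \<inter> D = {}" "C \<inter> D = {}"
    unfolding A_def B_def C_def D by auto
  \<comment> \<open>A third field element is needed for the fourth part to be nonempty.\<close>
  obtain x :: 'a where x: "x \<noteq> 0" "x \<noteq> 1" using nontrivial by blast
  have "(1, 1 * \<theta> x) \<in> D"
    unfolding D mem_Collect_eq by (rule exI[of _ 1], rule exI[of _ x]) (simp add: x)
  moreover have "(1, 1 * \<theta> 1) \<in> B"
    unfolding B_def mem_Collect_eq by (rule exI[of _ 1]) simp
  moreover have "(1, 0) \<in> C" unfolding C_def by simp
  moreover have "(0, 0) \<in> A" unfolding A_def by simp
  ultimately have ne: "A \<noteq> {}" "B \<noteq> {}" "C \<noteq> {}" "D \<noteq> {}" by blast+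
  have "partition_on UNIV {A, B, C, D}" "distinct [A, B, C, D]"
    using partition_on_four[OF union disj ne] .
  then show ?thesis
    unfolding has_suzuki_partition_def Let_def suzuki_parts
    unfolding center_U carrier_U by (simp add: L A_def B_def C_def D_def)
qed

section \<open>Transitivity of the Hua subgroup on the center\<close>

text \<open>An element of the Hua subgroup moving \<open>(0, 1)\<close> to \<open>(0, d)\<close> has
  a factor \<open>l = \<theta> c\<close>, so \<open>d = l^(1+\<theta>)\<close> is the image of
  \<open>c^(1+\<theta>)\<close> under \<theta>.\<close>

lemma surj_if_transitive:
  assumes "transitive_on (hua_subgroup U T) (center U - {\<one>\<^bsub>U\<^esub>})"
  shows "surj \<theta>"
proof (rule surj_if_subset, rule subsetI)
  fix d assume "d \<in> L"
  show "d \<in> range \<theta>"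
  proof (cases "d = 0")
    case True
    then show ?thesis by (metis rangeI theta_zero)
  next
    case False
    then have "(0, 1) \<in> center U - {\<one>\<^bsub>U\<^esub>}" "(0, d) \<in> center U - {\<one>\<^bsub>U\<^esub>}"
      using \<open>d \<in> L\<close> unfolding center_nonzero by auto
    then obtain h where "h \<in> hua_subgroup U T" "h (Some (0, 1)) = Some (0, d)"
      using assms unfolding transitive_on_def by blast
    then obtain l where "l \<in> scalars" "hua l (Some (0, 1)) = Some (0, d)"
      using hua_subgroup_subset by blast
    moreover then obtain c where "l = \<theta> c" unfolding scalars_def by blast
    ultimately have "d = \<theta> (c * \<theta> c)" by simp
    then show ?thesis by blast
  qed
qed

lemma transitive_if_surj:
  assumes surj: "surj \<theta>"
  shows "transitive_on (hua_subgroup U T) (center U - {\<one>\<^bsub>U\<^esub>})"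
  unfolding transitive_on_def
proof (intro ballI)
  fix x y assume "x \<in> center U - {\<one>\<^bsub>U\<^esub>}" "y \<in> center U - {\<one>\<^bsub>U\<^esub>}"
  then obtain p q where pq: "x = (0, p)" "p \<noteq> 0" "y = (0, q)" "q \<noteq> 0"
    unfolding center_nonzero by auto
  have L [simp]: "x \<in> L" for x using L_eq_UNIV[OF surj] by simp
  \<comment> \<open>Squaring is \<theta> applied twice, hence surjective. The product
    \<open>h\<close> below multiplies central coordinates by
    \<open>\<theta> (N 0 t) = t^2\<close>.\<close>
  obtain t where t: "t\<^sup>2 = q / p" using surj by (metis surjD theta_theta)
  then have "t \<noteq> 0" using pq by auto
  define h where "h = mu U T (0, 1) \<otimes>\<^bsub>sym_points U\<^esub> mu U T (0, t)"
  have nonid: "(0, 1) \<in> nonid U" "(0, t) \<in> nonid U"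
    using \<open>t \<noteq> 0\<close> by (simp_all add: nonid_def)
  then have "h = hua (mu_factor 0 t)"
    using mu_mult_mu(1)[OF nonid] by (simp add: h_def mu_factor_def norm_zero_left)
  then have "h (Some x) = Some y"
    using mu_factor_mult_theta[of 0 t] pq t by (simp add: norm_zero_left)
  moreover have "h \<in> hua_subgroup U T"
    unfolding hua_subgroup_def h_def using nonid by (intro generate.incl) blast
  ultimately show "\<exists>h\<in>hua_subgroup U T. h (Some x) = Some y" by blast
qed

section \<open>Central representatives of the classes of equal \<mu>\<close>

text \<open>For \<open>(x, 1)\<close> and a central \<open>(0, t)\<close>, equality of \<mu> means
  equality of norms. All terms of \<open>N x 1 = \<theta> t\<close> other than \<open>x\<close>
  itself lie in the range of \<theta>, hence so does \<open>x\<close>.\<close>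

lemma surj_if_mu_classes:
  assumes "\<forall>a \<in> nonid U. \<exists>b \<in> center U - {\<one>\<^bsub>U\<^esub>}. a \<in> mu_class U T b"
  shows "surj \<theta>"
proof (rule surj_if_subset, rule subsetI)
  fix x assume x: "x \<in> L"
  then have "(x, 1) \<in> nonid U" by (simp add: nonid_def)
  then obtain t where t: "t \<in> L" "t \<noteq> 0" "mu U T (x, 1) = mu U T (0, t)"
    using assms unfolding center_nonzero mu_class_def by blast
  \<comment> \<open>As \<open>(1, 0)\<tau> = (0, 1)\<close>, evaluation at this single point
    recovers the norm.\<close>
  have mu_at: "mu U T (a, b) (Some (1, 0)) = Some (0, \<theta> (N a b))"
    if "a \<in> L" "b \<in> L" "a \<noteq> 0 \<or> b \<noteq> 0" for a b
    using that by (simp add: mu_eq tau_Some suzuki_norm_def mu_factor_mult_theta[unfolded suzuki_norm_def])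
  have "\<theta> (N x 1) = \<theta> (N 0 t)"
    using mu_at[of x 1] mu_at[of 0 t] x t by simp
  then have "x\<^sup>2 * \<theta> x + x + 1 = \<theta> t"
    by (simp only: theta_eq_iff) (simp add: suzuki_norm_def)
  then have "x = \<theta> t + 1 + x\<^sup>2 * \<theta> x"
    by (metis add_self_left add.commute add.left_commute)
  also have "\<dots> = \<theta> (t + 1 + \<theta> x * x)" by simp
  finally show "x \<in> range \<theta>" by (metis rangeI)
qed

text \<open>The permutation \<mu> depends only on the norm, and surjectivity yields a central
  element of any prescribed nonzero norm, since \<open>N 0 t = \<theta> t\<close>.\<close>

lemma mu_classes_if_surj:
  assumes surj: "surj \<theta>"
  shows "\<forall>a \<in> nonid U. \<exists>b \<in> center U - {\<one>\<^bsub>U\<^esub>}. a \<in> mu_class U T b"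
proof
  fix u assume u: "u \<in> nonid U"
  then obtain a b where ab: "u = (a, b)" "a \<noteq> 0 \<or> b \<noteq> 0" by (cases u) (auto simp: nonid_def)
  have L [simp]: "x \<in> L" for x using L_eq_UNIV[OF surj] by simp
  obtain t where t: "\<theta> t = N a b" using surj by (metis surjD)
  then have "t \<noteq> 0" using ab by (metis norm_eq_zero_iff theta_zero)
  then have "mu U T u = mu U T (0, t)"
    using ab t by (simp add: mu_eq mu_factor_def norm_zero_left)
  then have "u \<in> mu_class U T (0, t)" using u by (simp add: mu_class_def)
  moreover have "(0, t) \<in> center U - {\<one>\<^bsub>U\<^esub>}" unfolding center_nonzero using \<open>t \<noteq> 0\<close> by simp
  ultimately show "\<exists>b \<in> center U - {\<one>\<^bsub>U\<^esub>}. u \<in> mu_class U T b" by blast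
qed

end

theorem theorem6p1:
  fixes \<theta> :: "'a::field \<Rightarrow> 'a"
    and k L :: "'a set"
    and U :: "('a \<times> 'a) monoid"
    and \<tau> :: "('a \<times> 'a) option \<Rightarrow> ('a \<times> 'a) option"
    and H :: "(('a \<times> 'a) option \<Rightarrow> ('a \<times> 'a) option) set"
  assumes "CHAR('a) = 2"
    and "card (UNIV :: 'a set) \<noteq> 2"
    and "tits_endomorphism \<theta>"
    and "k = range \<theta>"
    and "subspace_over k L"
    and "1 \<in> L"
    and "generate_ring field_rec (k \<union> L) = UNIV"
    and "U = suzuki_group L \<theta>"
    and "\<tau> = suzuki_tau L \<theta>"
    and "H = hua_subgroup U \<tau>"
  shows "(surj \<theta> \<longleftrightarrow> perfect_field TYPE('a))
       \<and> (surj \<theta> \<longleftrightarrow> has_suzuki_partition U \<tau>)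
       \<and> (surj \<theta> \<longleftrightarrow> transitive_on H (center U - {\<one>\<^bsub>U\<^esub>}))
       \<and> (surj \<theta> \<longleftrightarrow> (\<forall>a \<in> nonid U. \<exists>b \<in> center U - {\<one>\<^bsub>U\<^esub>}. a \<in> mu_class U \<tau> b))"
proof -
  interpret tits_field \<theta>
  proof
    show "x + x = 0" for x :: 'a using assms(1) by (rule char_two_add_self)
    have hom: "\<theta> \<in> ring_hom field_rec field_rec" and "\<And>x. \<theta> (\<theta> x) = x ^ 2"
      using assms(3) by (auto simp: tits_endomorphism_def)
    then show "\<theta> (\<theta> x) = x\<^sup>2" for x by simp
    show "\<theta> (x + y) = \<theta> x + \<theta> y" "\<theta> (x * y) = \<theta> x * \<theta> y" "\<theta> 1 = 1" for x y
      using hom by (simp_all add: ring_hom_def ring_of_type_algebra_def)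
  qed
  interpret proper_suzuki \<theta> L
  proof
    have "card {0, 1 :: 'a} = 2" by simp
    then have "UNIV \<noteq> {0, 1 :: 'a}" using assms(2) by metis
    then show "\<exists>x::'a. x \<noteq> 0 \<and> x \<noteq> 1" by blast
  qed (use assms in \<open>auto simp: subspace_over_def\<close>)
  \<comment> \<open>Squaring is \<open>\<theta> \<circ> \<theta>\<close>, so every square lies in
    the range of \<theta>.\<close>
  have "surj \<theta> \<longleftrightarrow> surj (\<lambda>x::'a. x\<^sup>2)"
  proof
    assume "surj \<theta>"
    then have "surj (\<theta> \<circ> \<theta>)" by (rule comp_surj) fact
    then show "surj (\<lambda>x::'a. x\<^sup>2)" unfolding comp_def theta_theta .
  next
    assume sq: "surj (\<lambda>x::'a. x\<^sup>2)"
    have "y \<in> range \<theta>" for y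
    proof -
      obtain x where "y = x\<^sup>2" using sq by (rule surjE)
      then have "y = \<theta> (\<theta> x)" by simp
      then show ?thesis by blast
    qed
    then show "surj \<theta>" by blast
  qed
  then have perfect: "surj \<theta> \<longleftrightarrow> perfect_field TYPE('a)"
    unfolding perfect_field_def assms(1) by simp
  show ?thesis
    unfolding assms(8-10)
    by (intro conjI perfect iffI[OF suzuki_partition_if_surj surj_if_suzuki_partition]
      iffI[OF transitive_if_surj surj_if_transitive] iffI[OF mu_classes_if_surj surj_if_mu_classes])
qed

end
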